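(* Fix a target vector $x^*\in\mathbb{S}^{d-1}$, let $0<\lambda\le\sqrt2$, $0<\mu\le1$, $r\ge1$, and let $g$ be a tangent vector field, $g(x)\in\mathrm{T}_x\mathbb{S}^{d-1}$, that is $(\mu,r)$-RGA at $(x,x^* )$ for every $x\in\mathcal S_\lambda=\{x\in\mathbb{S}^{d-1}:\|x-x^*\|_2\le\lambda\}$. Let $\bar\theta=2\arcsin(\lambda/2)$ and define step sizes as follows: if $r=1$, $\eta_k=\sin(\bar\theta/2)\mu(1-\mu^2/8)^k/\|g(x^k)\|_2$; if $r>1$, with $\bar k=\lfloor 4/((r-1)\mu^2(\sin(\bar\theta/2)/2)^{2(r-1)})\rfloor-1$, $\eta_k=\mu\sin^r(\bar\theta/2)/\|g(x^k)\|_2$ for $k\le\bar k-1$ and $\eta_k=\big(\frac{4}{\mu^2(r-1)(k+1)}\big)^{r/(2r-2)}\mu/\|g(x^k)\|_2$ for $k\ge\bar k$. Then, starting from any $x^0\in\mathcal S_\lambda$, all iterates of $$x^{k+1}=\frac{x^k-\eta_kg(x^k)}{\|x^k-\eta_kg(x^k)\|_2},\qquad k\ge0,$$ stay in $\mathcal S_\lambda$, and hence $g$ is $(\mu,r)$-RGA at $(x^k,x^* )$ for every $k\geq 0$.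
   Context: $\mathbb{S}^{d-1}$ is the Euclidean unit sphere in $\mathbb{R}^d$; $\mathrm{T}_x\mathbb{S}^{d-1}=\{y\in\mathbb{R}^d:y\perp x\}$; $\theta(x,y)=\arccos(x\cdot y)$ for unit vectors. A tangent vector field $g$ is $(\mu,r)$-RGA at $(x,x^* )$ if $g(x)\ne0$ whenever $x\ne x^*$, and $g(x)\cdot x^*\le-\mu\sin^r(\theta(x,x^* ))\|g(x)\|_2$. Convention: if $g(x^k)=0$ (under RGA possible only when $x^k=x^*$), the iteration stays put, $x^{k+1}=x^k$. *)

theory Defs
  imports "HOL-Analysis.Analysis"
begin

definition tangent_space :: "real ^ 'd \<Rightarrow> (real ^ 'd) set" where
  "tangent_space x = {y. orthogonal y x}"

definition tangent_vector_field :: "(real ^ 'd \<Rightarrow> real ^ 'd) \<Rightarrow> bool" where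
  "tangent_vector_field g \<longleftrightarrow> (\<forall>x \<in> sphere 0 1. g x \<in> tangent_space x)"

definition sphere_angle :: "real ^ 'd \<Rightarrow> real ^ 'd \<Rightarrow> real" where
  "sphere_angle x y = arccos (x \<bullet> y)"

definition RGA ::
  "(real ^ 'd \<Rightarrow> real ^ 'd) \<Rightarrow> real \<Rightarrow> real \<Rightarrow> real ^ 'd \<Rightarrow> real ^ 'd \<Rightarrow> bool" where
  "RGA g \<mu> r x xs \<longleftrightarrow>
     (x \<noteq> xs \<longrightarrow> g x \<noteq> 0) \<and>
     g x \<bullet> xs \<le> - \<mu> * sin (sphere_angle x xs) powr r * norm (g x)"

definition spherical_cap :: "real ^ 'd \<Rightarrow> real \<Rightarrow> (real ^ 'd) set" where
  "spherical_cap xs l = {x \<in> sphere 0 1. norm (x - xs) \<le> l}"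

definition theta_bar :: "real \<Rightarrow> real" where
  "theta_bar l = 2 * arcsin (l / 2)"

text \<open>The switching index is kept as an integer, so that no truncated subtraction occurs.\<close>

definition k_bar :: "real \<Rightarrow> real \<Rightarrow> real \<Rightarrow> int" where
  "k_bar l \<mu> r =
     \<lfloor>4 / ((r - 1) * \<mu>\<^sup>2 * (sin (theta_bar l / 2) / 2) powr (2 * (r - 1)))\<rfloor> - 1"

text \<open>The step size at iteration \<open>k\<close>, where \<open>v\<close> is the value of the vector field
  at the current iterate. Only \<open>r \<ge> 1\<close> is meaningful.\<close>

definition step_size :: "real \<Rightarrow> real \<Rightarrow> real \<Rightarrow> nat \<Rightarrow> real ^ 'd \<Rightarrow> real" where
  "step_size l \<mu> r k v =
     (if r = 1 then
        sin (theta_bar l / 2) * \<mu> * (1 - \<mu>\<^sup>2 / 8) ^ k / norm v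
      else if int k \<le> k_bar l \<mu> r - 1 then
        \<mu> * sin (theta_bar l / 2) powr r / norm v
      else
        (4 / (\<mu>\<^sup>2 * (r - 1) * (real k + 1))) powr (r / (2 * r - 2)) * \<mu> / norm v)"

text \<open>One normalised gradient-type step; at a zero of \<open>g\<close>, where the step size is
  undefined, the iteration stays put.\<close>

definition sphere_step ::
  "(real ^ 'd \<Rightarrow> real ^ 'd) \<Rightarrow> real \<Rightarrow> real ^ 'd \<Rightarrow> real ^ 'd" where
  "sphere_step g \<eta> x =
     (if g x = 0 then x else (x - \<eta> *\<^sub>R g x) /\<^sub>R norm (x - \<eta> *\<^sub>R g x))"

end

theory Submission
  imports Defs
begin

text \<open>
  Write \<open>s = sin (theta_bar l / 2) = l / 2\<close>, so that the cap consists of the unit vectors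
  \<open>y\<close> with \<open>y \<bullet> xs \<ge> 1 - 2 s\<^sup>2\<close>, and let \<open>a = \<eta> \<parallel>g y\<parallel>\<close> be the length of the step before
  normalisation. The theorem rests on two facts.

  Every step satisfies \<open>a \<le> \<mu> s\<^sup>r\<close> (\<open>step_size_norm_le\<close>). Only the steps after
  the switching index need an argument: there \<open>a = \<mu> (s/2)\<^sup>r q\<^sup>e\<close> with \<open>e = r / (2r - 2)\<close>
  and \<open>q = M / (k + 1)\<close>, where \<open>M\<close> is the number whose floor defines the
  switching index. Rounding costs little: \<open>q \<le> 1 + (r - 1) \<le> 4\<^bsup>r - 1\<^esup>\<close>, so that
  \<open>q\<^sup>e \<le> 2\<^sup>r\<close>.

  A step with \<open>a \<le> \<mu> s\<^sup>r\<close> does not leave the cap (\<open>sphere_step_in_cap\<close>). With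
  \<open>c = y \<bullet> xs = cos \<theta>\<close>, orthogonality of \<open>g y\<close> and \<open>y\<close> shows that the new cosine is at least
  \<open>(c + a \<mu> sin\<^sup>r \<theta>) / sqrt (1 + a\<^sup>2)\<close>; moreover \<open>c \<ge> 0\<close> because \<open>l \<le> sqrt 2\<close>. If \<open>sin \<theta> \<ge> s\<close>, then
  \<open>\<mu> sin\<^sup>r \<theta> \<ge> a\<close> and the new cosine is at least \<open>c\<close>. If \<open>sin \<theta> < s\<close>, then \<open>y\<close> lies in the cap of
  half the angle, from which a step of length at most \<open>s\<close> cannot escape.
\<close>

section \<open>The size of the steps\<close>

lemma sin_half_theta_bar:
  assumes "0 < l" "l \<le> sqrt 2"
  shows "sin (theta_bar l / 2) = l / 2"
proof -
  have "sqrt 2 \<le> (2::real)" by (rule real_le_lsqrt) auto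
  then show ?thesis using assms by (simp add: theta_bar_def)
qed

lemma one_add_le_four_powr:
  fixes t :: real
  assumes "0 \<le> t"
  shows "1 + t \<le> 4 powr t"
proof -
  have "exp 1 \<le> (4::real)" using exp_le by linarith
  then have "1 \<le> ln (4::real)" by (simp add: ln_ge_iff)
  then have "1 + t \<le> 1 + t * ln 4"
    using assms by (simp add: mult_le_cancel_left1)
  also have "\<dots> \<le> exp (t * ln 4)" by (rule exp_ge_add_one_self)
  finally show ?thesis by (simp add: powr_def)
qed

text \<open>The bound on the decaying steps, with \<open>n = k + 1\<close>.\<close>

lemma late_step_factor_le:
  fixes s \<mu> r n :: real
  assumes s: "0 < s" "s \<le> 1" and \<mu>: "0 < \<mu>" "\<mu> \<le> 1" and r: "1 < r" and n: "1 \<le> n"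
    and switch: "of_int \<lfloor>4 / ((r - 1) * \<mu>\<^sup>2 * (s / 2) powr (2 * (r - 1)))\<rfloor> \<le> n"
  shows "(4 / (\<mu>\<^sup>2 * (r - 1) * n)) powr (r / (2 * r - 2)) \<le> s powr r"
proof -
  define t where "t = r - 1"
  define w where "w = (s / 2) powr (2 * t)"
  define M where "M = 4 / (t * \<mu>\<^sup>2 * w)"
  have t: "0 < t" and w: "0 < w" using r s by (auto simp: t_def w_def)
  have "w \<le> 1"
    unfolding w_def using s t by (intro powr_le1) auto
  moreover have "\<mu>\<^sup>2 \<le> 1" using \<mu> by (simp add: power_le_one)
  ultimately have "\<mu>\<^sup>2 * w \<le> 1"
    using \<mu> w by (intro mult_le_one) auto
  then have "t * \<mu>\<^sup>2 * w \<le> t"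
    using mult_left_mono[of "\<mu>\<^sup>2 * w" 1 t] t by (simp add: mult.assoc)
  then have M4: "4 / t \<le> M"
    unfolding M_def using t w \<mu> by (intro divide_left_mono) auto
  have Mn: "M \<le> n + 1"
    using switch unfolding M_def w_def t_def by linarith
  \<comment> \<open>If \<open>t < 1\<close>, then \<open>M \<ge> 4 / t\<close> forces \<open>n \<ge> 1 / t\<close>.\<close>
  have "1 \<le> t * n"
  proof (cases "1 \<le> t")
    case True
    then show ?thesis using n mult_mono[of 1 t 1 n] by simp
  next
    case False
    have "4 / t \<le> n + 1" using M4 Mn by simp
    then have "4 \<le> t * n + t" using t by (simp add: field_simps)
    then show ?thesis using False by simp
  qed
  then have "M / n \<le> 1 + t"
    using Mn n by (simp add: field_simps)
  also have "\<dots> \<le> 4 powr t" using t by (intro one_add_le_four_powr) simp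
  finally have q: "M / n \<le> 4 powr t" .
  have "4 / (\<mu>\<^sup>2 * (r - 1) * n) = w * (M / n)"
    using w by (simp add: M_def t_def mult.commute)
  also have "\<dots> \<le> w * 4 powr t" using q w by (intro mult_left_mono) auto
  also have "4 powr t = 2 powr (2 * t)"
    by (simp add: powr_powr[symmetric])
  also have "w * 2 powr (2 * t) = s powr (2 * t)"
    using s by (simp add: w_def powr_mult[symmetric])
  finally have "(4 / (\<mu>\<^sup>2 * (r - 1) * n)) powr (r / (2 * r - 2))
      \<le> (s powr (2 * t)) powr (r / (2 * r - 2))"
    using r n \<mu> by (intro powr_mono2) auto
  also have "(s powr (2 * t)) powr (r / (2 * r - 2)) = s powr r"
  proof -
    have "2 * r - 2 = 2 * t" by (simp add: t_def)
    then show ?thesis using t by (simp add: powr_powr)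
  qed
  finally show ?thesis .
qed

lemma step_size_nonneg:
  assumes "0 < l" "l \<le> sqrt 2" "0 < \<mu>" "\<mu> \<le> 1"
  shows "0 \<le> step_size l \<mu> r k v"
proof -
  have "\<mu>\<^sup>2 \<le> 1" using assms by (simp add: power_le_one)
  then show ?thesis
    using assms by (simp add: step_size_def sin_half_theta_bar)
qed

lemma step_size_norm_le:
  fixes v :: "real ^ 'd"
  assumes l: "0 < l" "l \<le> sqrt 2" and \<mu>: "0 < \<mu>" "\<mu> \<le> 1" and r: "1 \<le> r"
    and v: "v \<noteq> 0"
  shows "step_size l \<mu> r k v * norm v \<le> \<mu> * (l / 2) powr r"
proof (cases "r = 1")
  case True
  have "\<mu>\<^sup>2 \<le> 1" using \<mu> by (simp add: power_le_one)
  then have "(1 - \<mu>\<^sup>2 / 8) ^ k \<le> 1" by (intro power_le_one) auto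
  then have "l * \<mu> / 2 * (1 - \<mu>\<^sup>2 / 8) ^ k \<le> l * \<mu> / 2"
    using l \<mu> by (intro mult_left_le) auto
  then show ?thesis
    using True l \<mu> v by (simp add: step_size_def sin_half_theta_bar mult.commute)
next
  case False
  then have r1: "1 < r" using r by simp
  show ?thesis
  proof (cases "int k \<le> k_bar l \<mu> r - 1")
    case True
    then show ?thesis
      using False l v by (simp add: step_size_def sin_half_theta_bar)
  next
    case late: False
    have "sqrt 2 \<le> (2::real)" by (rule real_le_lsqrt) auto
    then have "l / 2 \<le> 1" using l by simp
    moreover have "of_int \<lfloor>4 / ((r - 1) * \<mu>\<^sup>2 * (l / 2 / 2) powr (2 * (r - 1)))\<rfloor> \<le> real k + 1"
      using late l by (simp add: k_bar_def sin_half_theta_bar)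
    ultimately have "(4 / (\<mu>\<^sup>2 * (r - 1) * (real k + 1))) powr (r / (2 * r - 2)) \<le> (l / 2) powr r"
      using l \<mu> r1 by (intro late_step_factor_le) auto
    then show ?thesis
      using False late \<mu> v by (simp add: step_size_def mult.commute)
  qed
qed

section \<open>Invariance of the cap\<close>

lemma spherical_cap_iff_inner:
  fixes y xs :: "real ^ 'd"
  assumes "xs \<in> sphere 0 1" "0 < l"
  shows "y \<in> spherical_cap xs l \<longleftrightarrow> norm y = 1 \<and> 1 - l\<^sup>2 / 2 \<le> y \<bullet> xs"
proof -
  have "norm (y - xs) \<le> l \<longleftrightarrow> (norm (y - xs))\<^sup>2 \<le> l\<^sup>2"
    using assms by (simp add: power2_le_iff_abs_le)
  moreover have "(norm (y - xs))\<^sup>2 = 2 - 2 * (y \<bullet> xs)" if "norm y = 1"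
    using assms(1) that
    by (simp add: power2_norm_eq_inner inner_diff_left inner_diff_right inner_commute
        norm_eq_1)
  ultimately show ?thesis
    by (auto simp: spherical_cap_def field_simps)
qed

text \<open>The scalar core: \<open>c\<close> is the cosine of the angle to the target before the step and the
  left-hand side of the conclusion is the cosine guaranteed after it.\<close>

lemma cosine_after_step_ge:
  fixes a c s \<mu> r :: real
  assumes s: "0 < s" "s\<^sup>2 \<le> 1 / 2" and \<mu>: "0 < \<mu>" "\<mu> \<le> 1" and r: "1 \<le> r"
    and a: "0 \<le> a" "a \<le> \<mu> * s powr r" and c: "1 - 2 * s\<^sup>2 \<le> c" "c \<le> 1"
  shows "1 - 2 * s\<^sup>2 \<le> (c + a * (\<mu> * sqrt (1 - c\<^sup>2) powr r)) / sqrt (1 + a\<^sup>2)"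
proof -
  have c0: "0 \<le> c" using s c by linarith
  have D: "0 < sqrt (1 + a\<^sup>2)" by (simp add: add_pos_nonneg)
  show ?thesis
  proof (cases "s \<le> sqrt (1 - c\<^sup>2)")
    case True
    have "\<mu> * s powr r \<le> \<mu> * sqrt (1 - c\<^sup>2) powr r"
      using True s \<mu> r by (intro mult_left_mono powr_mono2) auto
    then have "a * a \<le> a * (\<mu> * sqrt (1 - c\<^sup>2) powr r)"
      using a by (intro mult_left_mono) auto
    moreover have "sqrt (1 + a\<^sup>2) \<le> 1 + a\<^sup>2"
      by (intro real_le_lsqrt self_le_power) auto
    then have "c * sqrt (1 + a\<^sup>2) \<le> c * (1 + a\<^sup>2)"
      using c0 by (rule mult_left_mono)
    moreover have "c * a\<^sup>2 \<le> a\<^sup>2" using c c0 by (simp add: mult_left_le_one_le)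
    ultimately have "c * sqrt (1 + a\<^sup>2) \<le> c + a * (\<mu> * sqrt (1 - c\<^sup>2) powr r)"
      by (simp add: power2_eq_square algebra_simps)
    then have "c \<le> (c + a * (\<mu> * sqrt (1 - c\<^sup>2) powr r)) / sqrt (1 + a\<^sup>2)"
      using D by (simp add: pos_le_divide_eq)
    then show ?thesis using c by linarith
  next
    case False
    then have "1 - c\<^sup>2 \<le> s\<^sup>2" by (intro sqrt_le_D) simp
    have s1: "s \<le> 1" using s by (intro power2_le_imp_le[of s 1]) auto
    have "s powr r \<le> s powr 1" using s s1 r by (intro powr_mono') auto
    then have "\<mu> * s powr r \<le> 1 * s"
      using s \<mu> by (intro mult_mono) auto
    then have "a\<^sup>2 \<le> s\<^sup>2" using a by (intro power_mono) auto
    have "(1 - s\<^sup>2)\<^sup>2 * (1 + a\<^sup>2) \<le> (1 - s\<^sup>2)\<^sup>2 * (1 + s\<^sup>2)"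
      using \<open>a\<^sup>2 \<le> s\<^sup>2\<close> by (intro mult_left_mono) auto
    also have "\<dots> = (1 - s\<^sup>2) * (1 - (s\<^sup>2)\<^sup>2)" by algebra
    also have "\<dots> \<le> (1 - s\<^sup>2) * 1" using s by (intro mult_left_mono) auto
    also have "\<dots> \<le> c\<^sup>2" using \<open>1 - c\<^sup>2 \<le> s\<^sup>2\<close> by simp
    finally have "((1 - s\<^sup>2) * sqrt (1 + a\<^sup>2))\<^sup>2 \<le> c\<^sup>2"
      by (simp add: power_mult_distrib)
    then have "(1 - s\<^sup>2) * sqrt (1 + a\<^sup>2) \<le> c"
      using c0 by (rule power2_le_imp_le)
    also have "\<dots> \<le> c + a * (\<mu> * sqrt (1 - c\<^sup>2) powr r)"
      using a \<mu> by simp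
    finally have "1 - s\<^sup>2 \<le> (c + a * (\<mu> * sqrt (1 - c\<^sup>2) powr r)) / sqrt (1 + a\<^sup>2)"
      using D by (simp add: pos_le_divide_eq)
    then show ?thesis using zero_le_power2[of s] by linarith
  qed
qed

lemma sphere_step_in_cap:
  fixes xs y :: "real ^ 'd"
  assumes xs: "xs \<in> sphere 0 1" and l: "0 < l" "l \<le> sqrt 2" and \<mu>: "0 < \<mu>" "\<mu> \<le> 1"
    and r: "1 \<le> r" and tangent: "orthogonal (g y) y" and rga: "RGA g \<mu> r y xs"
    and y: "y \<in> spherical_cap xs l"
    and \<eta>: "0 \<le> \<eta>" "g y \<noteq> 0 \<Longrightarrow> \<eta> * norm (g y) \<le> \<mu> * (l / 2) powr r"
  shows "sphere_step g \<eta> y \<in> spherical_cap xs l"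
proof (cases "g y = 0")
  case True
  then show ?thesis using y by (simp add: sphere_step_def)
next
  case False
  define a where "a = \<eta> * norm (g y)"
  define c where "c = y \<bullet> xs"
  define z where "z = y - \<eta> *\<^sub>R g y"
  have y1: "norm y = 1" and cl: "1 - l\<^sup>2 / 2 \<le> c"
    using y spherical_cap_iff_inner[OF xs l(1)] by (auto simp: c_def)
  have c1: "\<bar>c\<bar> \<le> 1"
    using Cauchy_Schwarz_ineq2[of y xs] y1 xs by (simp add: c_def)
  have "(norm z)\<^sup>2 = 1 + a\<^sup>2"
    using tangent y1 unfolding z_def a_def power2_norm_eq_inner power_mult_distrib
    by (simp add: inner_diff_left inner_diff_right orthogonal_def inner_commute norm_eq_1
        power2_eq_square)
  then have nz: "norm z = sqrt (1 + a\<^sup>2)" by (metis norm_ge_zero real_sqrt_unique)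
  have z0: "0 < norm z" by (simp add: nz add_pos_nonneg)
  have "g y \<bullet> xs \<le> - (\<mu> * sqrt (1 - c\<^sup>2) powr r * norm (g y))"
    using rga c1 by (simp add: RGA_def sphere_angle_def c_def sin_arccos_abs)
  then have "\<eta> * (\<mu> * sqrt (1 - c\<^sup>2) powr r * norm (g y)) \<le> \<eta> * - (g y \<bullet> xs)"
    using \<eta>(1) by (intro mult_left_mono) auto
  then have "c + a * (\<mu> * sqrt (1 - c\<^sup>2) powr r) \<le> z \<bullet> xs"
    by (simp add: z_def c_def a_def inner_diff_left algebra_simps)
  then have "(c + a * (\<mu> * sqrt (1 - c\<^sup>2) powr r)) / sqrt (1 + a\<^sup>2) \<le> z \<bullet> xs / norm z"
    unfolding nz by (intro divide_right_mono) auto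
  moreover have "l\<^sup>2 \<le> 2" using power_mono[of l "sqrt 2" 2] l by simp
  then have "1 - 2 * (l / 2)\<^sup>2 \<le> (c + a * (\<mu> * sqrt (1 - c\<^sup>2) powr r)) / sqrt (1 + a\<^sup>2)"
    using l \<mu> r \<eta> False cl c1
    by (intro cosine_after_step_ge) (auto simp: a_def power_divide)
  ultimately have cap: "1 - l\<^sup>2 / 2 \<le> z \<bullet> xs / norm z" by (simp add: power_divide)
  have "sphere_step g \<eta> y = z /\<^sub>R norm z"
    using False by (simp add: sphere_step_def z_def)
  moreover have "norm (z /\<^sub>R norm z) = 1" using z0 by simp
  moreover have "(z /\<^sub>R norm z) \<bullet> xs = z \<bullet> xs / norm z"
    by (simp only: inner_scaleR_left divide_inverse mult.commute)
  ultimately show ?thesis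
    using cap by (simp only: spherical_cap_iff_inner[OF xs l(1)])
qed

theorem claim3p2:
  fixes xs :: "real ^ 'd" and g :: "real ^ 'd \<Rightarrow> real ^ 'd"
    and l \<mu> r :: real and x :: "nat \<Rightarrow> real ^ 'd"
  assumes "xs \<in> sphere 0 1"
    and "0 < l" and "l \<le> sqrt 2"
    and "0 < \<mu>" and "\<mu> \<le> 1"
    and "1 \<le> r"
    and "tangent_vector_field g"
    and "\<forall>y \<in> spherical_cap xs l. RGA g \<mu> r y xs"
    and "x 0 \<in> spherical_cap xs l"
    and "\<forall>k. x (Suc k) = sphere_step g (step_size l \<mu> r k (g (x k))) (x k)"
  shows "(\<forall>k. x k \<in> spherical_cap xs l) \<and> (\<forall>k. RGA g \<mu> r (x k) xs)"
proof -
  have "x k \<in> spherical_cap xs l" for k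
  proof (induction k)
    case 0
    show ?case by fact
  next
    case (Suc k)
    then have "x k \<in> sphere 0 1" by (simp add: spherical_cap_def)
    then have "orthogonal (g (x k)) (x k)"
      using assms(7) by (auto simp: tangent_vector_field_def tangent_space_def)
    moreover have "RGA g \<mu> r (x k) xs" using Suc assms(8) by blast
    ultimately have "sphere_step g (step_size l \<mu> r k (g (x k))) (x k) \<in> spherical_cap xs l"
      using assms(1-6) Suc
      by (intro sphere_step_in_cap[where \<mu> = \<mu> and r = r] step_size_nonneg step_size_norm_le)
    then show ?case using assms(10) by simp
  qed
  then show ?thesis using assms(8) by blast
qed

end
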